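(* Let $f(z)=zh(z)\overline{g(z)}\in T_{Lh}$, let $0<r<1$, and suppose $|f(z)|\le M(r)$ for $|z|=r$. Let $L(r)$ denote the arclength of the image of the circle $|z|=r$ under $f$, i.e. $L(r)=\int_0^{2\pi}\left|\frac{\partial}{\partial\theta}f(re^{i\theta})\right|d\theta$. Then $$L(r)\le 4\pi M(r)\,\frac{1+r+2r^2-2r^3}{(1-r)(1-r^2)}.$$
   Context: $U=\{z\in\mathbb{C}:|z|<1\}$; $\mathcal{H}(U)$ is the space of analytic functions on $U$; $B$ is the set of $a\in\mathcal{H}(U)$ with $|a|<1$ in $U$. A function $f$ on $U$ is a logharmonic mapping with respect to $a\in B$ if $\overline{\left(f_{\overline z}/f\right)}=a\,f_z/f$ in $U$ (where $f\neq 0$). An analytic function $\varphi$ in $U$ is typically real if $\varphi(z)$ is real whenever $z\in U$ is real and $\varphi(z)$ is nonreal for all other $z\in U$. $T_{Lh}$ is the class of logharmonic mappings $f(z)=zh(z)\overline{g(z)}$ in $U$ (with respect to some $a\in B$), where $h,g\in\mathcal{H}(U)$, $h(0)=1=g(0)$, $0\notin(hg)(U)$, such that $\varphi(z)=zh(z)g(z)$ is typically real in $U$. *)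

theory Defs
  imports "HOL-Complex_Analysis.Complex_Analysis"
begin

abbreviation unit_disk :: "complex set" where
  "unit_disk \<equiv> ball 0 1"

definition dilatations :: "(complex \<Rightarrow> complex) set" where
  "dilatations = {a. a holomorphic_on unit_disk \<and> (\<forall>z\<in>unit_disk. norm (a z) < 1)}"

text \<open>The Wirtinger derivatives \<open>f\<^sub>z = (f\<^sub>x - i f\<^sub>y) / 2\<close> and \<open>f\<^bsub>z-bar\<^esub> = (f\<^sub>x + i f\<^sub>y) / 2\<close>.
  The partial derivatives \<open>f\<^sub>x\<close> and \<open>f\<^sub>y\<close> are the values of the (real) Frechet derivative
  in the directions \<open>1\<close> and \<open>\<i>\<close>.\<close>

definition wirtinger :: "(complex \<Rightarrow> complex) \<Rightarrow> complex \<Rightarrow> complex" where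
  "wirtinger f z =
     (frechet_derivative f (at z) 1 - \<i> * frechet_derivative f (at z) \<i>) / 2"

definition wirtinger_bar :: "(complex \<Rightarrow> complex) \<Rightarrow> complex \<Rightarrow> complex" where
  "wirtinger_bar f z =
     (frechet_derivative f (at z) 1 + \<i> * frechet_derivative f (at z) \<i>) / 2"

text \<open>Real differentiability is stated explicitly because \<^const>\<open>frechet_derivative\<close> is
  unspecified where \<open>f\<close> is not differentiable.\<close>

definition logharmonic_wrt :: "(complex \<Rightarrow> complex) \<Rightarrow> (complex \<Rightarrow> complex) \<Rightarrow> bool" where
  "logharmonic_wrt a f \<longleftrightarrow>
     (\<forall>z\<in>unit_disk. f differentiable (at z)) \<and>
     (\<forall>z\<in>unit_disk. f z \<noteq> 0 \<longrightarrow> cnj (wirtinger_bar f z / f z) = a z * (wirtinger f z / f z))"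

definition typically_real :: "(complex \<Rightarrow> complex) \<Rightarrow> bool" where
  "typically_real \<phi> \<longleftrightarrow>
     \<phi> holomorphic_on unit_disk \<and> (\<forall>z\<in>unit_disk. \<phi> z \<in> \<real> \<longleftrightarrow> z \<in> \<real>)"

definition T_Lh :: "(complex \<Rightarrow> complex) set" where
  "T_Lh = {f. (\<exists>a\<in>dilatations. logharmonic_wrt a f) \<and>
     (\<exists>h g. h holomorphic_on unit_disk \<and> g holomorphic_on unit_disk \<and>
        h 0 = 1 \<and> g 0 = 1 \<and> (\<forall>z\<in>unit_disk. h z * g z \<noteq> 0) \<and>
        (\<forall>z\<in>unit_disk. f z = z * h z * cnj (g z)) \<and>
        typically_real (\<lambda>z. z * h z * g z))}"

definition image_circle_length :: "(complex \<Rightarrow> complex) \<Rightarrow> real \<Rightarrow> real" where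
  "image_circle_length f r =
     integral {0..2 * pi} (\<lambda>\<theta>. norm (vector_derivative (\<lambda>t. f (rcis r t)) (at \<theta>)))"

end

theory Submission
  imports Defs
begin

text \<open>
  Write \<open>\<phi>(z) = z h(z) g(z)\<close> and \<open>Q = 1 + z h'/h\<close>. The logharmonic equation says
  \<open>z g'/g = a Q\<close>, so the angular derivative of \<open>f\<close> is \<open>i f (Q - cnj (a Q))\<close>, while
  \<open>z \<phi>'/\<phi> = (1 + a) Q\<close>. At the origin the equation forces \<open>a(0) = 0\<close>, hence
  \<open>|a| \<le> r\<close> on \<open>|z| = r\<close> by the Schwarz lemma, and the integrand of \<open>L(r)\<close> is at most
  \<open>M(r) (1 + r) |z \<phi>'/\<phi>| / |1 + a|\<close>.

  The two remaining factors are treated differently. The logarithmic derivative of a typically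
  real function is bounded pointwise by \<open>(1 + r) / (1 - r)\<close>: Rogosinski's function
  \<open>p(z) = (1 - z\<^sup>2) \<phi>(z) / z\<close> has positive real part, and
  \<open>z \<phi>'/\<phi> = (1 + z\<^sup>2) / (1 - z\<^sup>2) + z p'/p\<close>, where the last term is controlled by the
  Schwarz-Pick inequality for the half plane (\<open>norm_log_derivative_typically_real\<close>).

  The factor \<open>1 / |1 + a|\<close> has to be averaged over the circle; its pointwise bound \<open>1 / (1 - r)\<close>
  would lose too much. Since \<open>1 + a\<close> lies in a disk of radius \<open>r\<close> about \<open>1\<close>, its argument is at
  most \<open>arcsin r\<close>, so that \<open>1 / |1 + a| \<le> Re (1 / (1 + a)) / sqrt (1 - r\<^sup>2)\<close>
  (\<open>inverse_norm_le_Re_inverse\<close>). The right-hand side is harmonic and its mean is its value at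
  the centre, \<open>1 / sqrt (1 - r\<^sup>2)\<close>. Altogether
  \<open>L(r) \<le> 2 \<pi> M(r) (1 + r)\<^sup>2 / ((1 - r) sqrt (1 - r\<^sup>2))\<close> (\<open>image_circle_length_le\<close>), which is
  smaller than the bound to be shown.
\<close>

section \<open>Typically real functions\<close>

text \<open>
  Off the real axis \<open>Im \<phi>\<close> has no zero, so its sign is constant on each half of the disk; near
  the origin \<open>\<phi>(z) \<approx> z\<close> because \<open>k 0 = 1\<close>, which fixes the sign.
\<close>

lemma Im_same_sign_of_typically_real:
  assumes tr: "typically_real (\<lambda>z. z * k z)" and k: "k holomorphic_on unit_disk" and k0: "k 0 = 1"
    and z: "z \<in> unit_disk"
  shows "0 \<le> Im z * Im (z * k z)"
proof (cases "Im z = 0")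
  case False
  have "isCont k 0"
    using holomorphic_on_imp_continuous_on[OF k] by (simp add: continuous_on_eq_continuous_at)
  hence "((\<lambda>t::real. Re (k (\<i> * t))) \<longlongrightarrow> Re (k (\<i> * 0))) (at 0)"
    by (intro tendsto_intros isCont_tendsto_compose[of _ k]) (auto intro!: tendsto_eq_intros)
  hence "eventually (\<lambda>t::real. Re (k (\<i> * t)) > 0) (at 0)"
    using k0 by (auto intro: order_tendstoD)
  then obtain d where d: "d > 0" "\<And>t::real. t \<noteq> 0 \<Longrightarrow> \<bar>t::real\<bar> < d \<Longrightarrow> Re (k (\<i> * t)) > 0"
    by (auto simp: eventually_at dist_real_def)
  \<comment> \<open>A point \<open>w = i t\<close> so close to the origin that the sign is known there, on the same side of the
    real axis as \<open>z\<close>; the segment from \<open>z\<close> to \<open>w\<close> then avoids the axis.\<close>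
  define t where "t = sgn (Im z) * (min d 1 / 2)"
  have t: "t \<noteq> 0" "\<bar>t\<bar> < d" "\<bar>t\<bar> < 1" "sgn t = sgn (Im z)"
    using d(1) False by (auto simp: t_def abs_mult sgn_mult abs_sgn_eq sgn_if)
  define w where "w = \<i> * complex_of_real t"
  have w: "w \<in> unit_disk" "Im w = t" using t by (auto simp: w_def norm_mult)
  let ?S = "closed_segment z w"
  have S: "?S \<subseteq> unit_disk" using z w(1) by (simp add: closed_segment_subset)
  have "closed_segment z w \<subseteq> {x. inner (\<i> * Im z) x > 0}"
  proof (rule closed_segment_subset)
    show "z \<in> {x. inner (\<i> * Im z) x > 0}"
      using False by (auto simp: inner_complex_def zero_less_mult_iff)
    show "w \<in> {x. inner (\<i> * Im z) x > 0}"
      using t(1,4) w(2) by (auto simp: inner_complex_def sgn_if zero_less_mult_iff split: if_splits)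
  qed (rule convex_halfspace_gt)
  hence same: "Im z * Im x > 0" if "x \<in> ?S" for x
    using that by (auto simp: inner_complex_def)
  let ?F = "\<lambda>x. Im x * Im (x * k x)"
  have cont: "continuous_on ?S ?F"
    by (intro continuous_intros holomorphic_on_imp_continuous_on holomorphic_on_subset[OF k S])
  have nz: "?F x \<noteq> 0" if "x \<in> ?S" for x
  proof -
    have "Im x \<noteq> 0" using same[OF that] by auto
    thus ?thesis using tr that S unfolding typically_real_def
      by (metis complex_is_Real_iff mult_eq_0_iff subsetD)
  qed
  have w0: "?F w > 0"
    using d(2)[OF t(1,2)] t(1) w(2) by (simp add: w_def mult.assoc[symmetric] power2_eq_square[symmetric])
  show ?thesis
  proof (rule ccontr)
    assume neg: "\<not> 0 \<le> Im z * Im (z * k z)"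
    have "connected (?F ` ?S)" by (intro connected_continuous_image cont connected_segment)
    hence "0 \<in> ?F ` ?S"
      by (rule connectedD_interval[of _ "?F z" "?F w"]) (use neg w0 in auto)
    thus False using nz by auto
  qed
qed auto

text \<open>
  On the unit circle \<open>1 - x\<^sup>2 = x (cnj x - x) = -2 i x Im x\<close>, so that
  \<open>Re ((1 - x\<^sup>2) k x) = 2 Im x Im (x k x)\<close>, which is nonnegative wherever \<open>Im x\<close> and
  \<open>Im (x k x)\<close> have the same sign. As \<open>k\<close> need not extend to the circle, the minimum principle
  is applied to the dilations \<open>k (\<rho> x)\<close>, and then \<open>\<rho>\<close> tends to \<open>1\<close>.
\<close>

lemma Re_nonneg_of_typically_real:
  assumes tr: "typically_real (\<lambda>z. z * k z)" and k: "k holomorphic_on unit_disk" and k0: "k 0 = 1"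
    and z: "z \<in> unit_disk"
  shows "0 \<le> Re ((1 - z\<^sup>2) * k z)"
proof -
  have dil: "0 \<le> Re ((1 - z\<^sup>2) * k (of_real \<rho> * z))" if \<rho>: "0 < \<rho>" "\<rho> < 1" for \<rho> :: real
  proof -
    have Re_mult: "Re (of_real y * w) = y * Re w" "Re (2 * \<i> * y * w) = - 2 * (y * Im w)"
      for y :: real and w by simp_all
    let ?G = "\<lambda>z. - ((1 - z\<^sup>2) * k (of_real \<rho> * z))"
    have hol: "?G holomorphic_on ball 0 (1 / \<rho>)"
    proof (intro holomorphic_intros holomorphic_on_compose_gen[OF _ k, unfolded o_def])
      show "(*) (complex_of_real \<rho>) ` ball 0 (1 / \<rho>) \<subseteq> unit_disk"
        using \<rho> by (auto simp: norm_mult field_simps)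
    qed
    have sub: "cball 0 1 \<subseteq> ball (0::complex) (1 / \<rho>)" 
    proof
      fix x :: complex assume "x \<in> cball 0 1"
      moreover have "1 < 1 / \<rho>" using \<rho> by simp
      ultimately show "x \<in> ball 0 (1 / \<rho>)" by simp
    qed
    have "Re (?G z) \<le> 0"
    proof (rule maximum_real_frontier[where S = "cball 0 1" and f = ?G])
      show "?G holomorphic_on interior (cball 0 1)"
        by (rule holomorphic_on_subset[OF hol]) (use sub interior_subset in blast)
      show "continuous_on (closure (cball 0 1)) ?G"
        by (rule holomorphic_on_imp_continuous_on, rule holomorphic_on_subset[OF hol]) (use sub in auto)
      fix x :: complex assume "x \<in> frontier (cball 0 1)"
      hence x1: "norm x = 1" by simp
      hence "x * cnj x = 1" by (simp add: complex_norm_square[symmetric])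
      hence "1 - x\<^sup>2 = x * (cnj x - x)" by (simp add: algebra_simps power2_eq_square)
      moreover have "cnj x - x = - 2 * \<i> * Im x" by (simp add: complex_eq_iff)
      ultimately have "1 - x\<^sup>2 = - 2 * \<i> * Im x * x" by simp
      hence eq: "of_real \<rho> * ?G x = 2 * \<i> * Im x * ((of_real \<rho> * x) * k (of_real \<rho> * x))" by simp
      have "\<rho> * Re (?G x) = Re (of_real \<rho> * ?G x)" by (rule Re_mult(1)[symmetric])
      also have "\<dots> = - 2 * (Im x * Im ((of_real \<rho> * x) * k (of_real \<rho> * x)))"
        unfolding eq by (rule Re_mult(2))
      finally have *: "\<rho> * (\<rho> * Re (?G x)) = - 2 * (Im (of_real \<rho> * x) * Im ((of_real \<rho> * x) * k (of_real \<rho> * x)))"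
        by simp
      have "of_real \<rho> * x \<in> unit_disk" using x1 \<rho> by (simp add: norm_mult)
      from Im_same_sign_of_typically_real[OF tr k k0 this] * have "\<rho> * (\<rho> * Re (?G x)) \<le> 0" by linarith
      thus "Re (?G x) \<le> 0" using \<rho> by (simp add: mult_le_0_iff)
    qed (use z in auto)
    thus ?thesis by simp
  qed
  have "0 \<le> Re ((1 - z\<^sup>2) * k (of_real 1 * z))"
  proof (rule continuous_ge_on_closure[where S = "{0<..<1::real}" and f = "\<lambda>\<rho>. Re ((1 - z\<^sup>2) * k (of_real \<rho> * z))"])
    show "continuous_on (closure {0<..<1::real}) (\<lambda>\<rho>. Re ((1 - z\<^sup>2) * k (of_real \<rho> * z)))"
    proof (intro continuous_intros continuous_on_compose2[OF holomorphic_on_imp_continuous_on[OF k]])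
      show "(\<lambda>x. complex_of_real x * z) ` closure {0<..<1} \<subseteq> unit_disk"
      proof (rule image_subsetI)
        fix u :: real assume "u \<in> closure {0<..<1}"
        hence "0 \<le> u" "u \<le> 1" by auto
        thus "of_real u * z \<in> unit_disk"
          using z mult_left_le_one_le[of "norm z" u] by (simp add: norm_mult)
      qed
    qed
  qed (use dil in auto)
  thus ?thesis by simp
qed

text \<open>A zero of \<open>Re p\<close> would be an interior maximum of \<open>|exp (- p)|\<close>.\<close>

lemma Re_pos_of_Re_nonneg:
  assumes p: "p holomorphic_on unit_disk" and nonneg: "\<And>z. z \<in> unit_disk \<Longrightarrow> 0 \<le> Re (p z)"
    and p0: "0 < Re (p 0)" and z: "z \<in> unit_disk"
  shows "0 < Re (p z)"
proof (rule ccontr)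
  assume "\<not> ?thesis"
  hence z0: "Re (p z) = 0" using nonneg[OF z] by simp
  have "(\<lambda>w. exp (- p w)) constant_on unit_disk"
    by (rule maximum_modulus_principle[where U = unit_disk and \<xi> = z])
       (use z z0 nonneg in \<open>auto intro!: holomorphic_intros p\<close>)
  hence "norm (exp (- p z)) = norm (exp (- p 0))"
    using z unfolding constant_on_def by (metis centre_in_ball zero_less_one)
  thus False using z0 p0 by simp
qed

text \<open>
  Conjugation by a disk automorphism \<open>T\<close> with \<open>T 0 = z\<close> and by the map
  \<open>w \<mapsto> (w - p z) / (w + cnj (p z))\<close> from the right half plane to the disk reduces this to the
  derivative bound in the Schwarz lemma.
\<close>

lemma Schwarz_Pick_half_plane:
  assumes p: "p holomorphic_on unit_disk" and pos: "\<And>z. z \<in> unit_disk \<Longrightarrow> 0 < Re (p z)"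
    and z: "z \<in> unit_disk"
  shows "norm (deriv p z) * (1 - (norm z)\<^sup>2) \<le> 2 * Re (p z)"
proof -
  define T where "T = Moebius_function 0 (- z)"
  define \<psi> where "\<psi> = (\<lambda>w. (p (T w) - p z) / (p (T w) + cnj (p z)))"
  have T: "T holomorphic_on unit_disk" "T ` unit_disk \<subseteq> unit_disk" "T 0 = z"
    using z Moebius_function_holomorphic[of "- z" 0] Moebius_function_norm_lt_1[of "- z"]
    by (auto simp: T_def Moebius_function_of_zero)
  have nz: "p x + cnj (p z) \<noteq> 0" if "x \<in> unit_disk" for x
    using pos[OF that] pos[OF z] by (auto simp: complex_eq_iff)
  have hol: "\<psi> holomorphic_on unit_disk"
    unfolding \<psi>_def
  proof (intro holomorphic_intros holomorphic_on_compose_gen[OF _ p, unfolded o_def] T(1,2))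
    fix w assume "w \<in> unit_disk"
    thus "p (T w) + cnj (p z) \<noteq> 0" by (intro nz subsetD[OF T(2) imageI])
  qed
  have lt1: "norm (\<psi> w) < 1" if "norm w < 1" for w
  proof -
    have Tw: "T w \<in> unit_disk" using that by (intro subsetD[OF T(2) imageI]) simp
    have "(norm (p (T w) + cnj (p z)))\<^sup>2 - (norm (p (T w) - p z))\<^sup>2 = 4 * (Re (p (T w)) * Re (p z))"
      unfolding cmod_power2 by (simp add: power2_eq_square algebra_simps)
    hence "(norm (p (T w) - p z))\<^sup>2 < (norm (p (T w) + cnj (p z)))\<^sup>2"
      using mult_pos_pos[OF pos[OF Tw] pos[OF z]] by linarith
    hence "norm (p (T w) - p z) < norm (p (T w) + cnj (p z))"
      by (rule power2_less_imp_less) simp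
    thus ?thesis using nz[OF Tw] by (simp add: \<psi>_def norm_divide)
  qed
  have dT: "(T has_field_derivative of_real (1 - (norm z)\<^sup>2)) (at 0)"
    unfolding T_def Moebius_function_simple
    by (auto intro!: derivative_eq_intros simp flip: complex_norm_square)
  have dp: "(p has_field_derivative deriv p z) (at (T 0))"
    using holomorphic_derivI[OF p _ z] T(3) by simp
  define D where "D = deriv p z * of_real (1 - (norm z)\<^sup>2)"
  have dpT: "((\<lambda>w. p (T w)) has_field_derivative D) (at 0)"
    unfolding D_def by (rule DERIV_chain2[OF dp dT])
  have "(\<psi> has_field_derivative
      (D * (p z + cnj (p z)) - (p z - p z) * D) / ((p z + cnj (p z)) * (p z + cnj (p z)))) (at 0)"
    unfolding \<psi>_def using nz[OF z] by (auto intro!: derivative_eq_intros dpT simp: T(3))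
  hence "(\<psi> has_field_derivative D / (p z + cnj (p z))) (at 0)"
    using nz[OF z] by simp
  hence "deriv \<psi> 0 = deriv p z * of_real (1 - (norm z)\<^sup>2) / of_real (2 * Re (p z))"
    by (simp add: DERIV_imp_deriv complex_add_cnj D_def)
  moreover have "norm (deriv \<psi> 0) \<le> 1"
    by (rule Schwarz_Lemma(2)[where \<xi> = 0, OF hol]) (use lt1 in \<open>simp_all add: \<psi>_def T(3)\<close>)
  moreover have "0 \<le> 1 - (norm z)\<^sup>2" using z by (simp add: power_le_one)
  ultimately have "norm (deriv p z) * (1 - (norm z)\<^sup>2) / (2 * Re (p z)) \<le> 1"
    using pos[OF z] by (simp add: norm_mult norm_divide del: of_real_diff of_real_mult of_real_power)
  thus ?thesis using pos[OF z] by simp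
qed

text \<open>
  The expression on the left is the logarithmic derivative \<open>z \<phi>'/\<phi>\<close> of \<open>\<phi>(z) = z k(z)\<close>. The
  two summands coming from \<open>k = p / (1 - z\<^sup>2)\<close> are bounded by \<open>(1 + r\<^sup>2) / (1 - r\<^sup>2)\<close> and
  \<open>2 r / (1 - r\<^sup>2)\<close>, and these add up to \<open>(1 + r) / (1 - r)\<close>. The Koebe function
  \<open>z / (1 - z)\<^sup>2\<close> shows that the bound is sharp.
\<close>

lemma norm_log_derivative_typically_real:
  assumes tr: "typically_real (\<lambda>z. z * k z)" and k: "k holomorphic_on unit_disk" and k0: "k 0 = 1"
    and z: "z \<in> unit_disk"
  shows "norm (1 + z * deriv k z / k z) \<le> (1 + norm z) / (1 - norm z)"
proof -
  define p where "p = (\<lambda>z. (1 - z\<^sup>2) * k z)"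
  have p: "p holomorphic_on unit_disk" unfolding p_def by (intro holomorphic_intros k)
  have pos: "0 < Re (p w)" if "w \<in> unit_disk" for w
    by (rule Re_pos_of_Re_nonneg[OF p])
       (use Re_nonneg_of_typically_real[OF tr k k0] that in \<open>auto simp: p_def k0\<close>)
  have r: "norm z < 1" using z by simp
  have r2: "0 < 1 - (norm z)\<^sup>2" using r by (simp add: power_less_one_iff)
  have pz: "p z \<noteq> 0" using pos[OF z] by auto
  hence nz: "k z \<noteq> 0" "1 - z\<^sup>2 \<noteq> 0" by (auto simp: p_def)
  have "(p has_field_derivative - (2 * z) * k z + deriv k z * (1 - z\<^sup>2)) (at z)"
    unfolding p_def
    by (auto intro!: derivative_eq_intros holomorphic_derivI[OF k _ z])
  hence dp: "deriv p z = - (2 * z) * k z + deriv k z * (1 - z\<^sup>2)" by (rule DERIV_imp_deriv)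
  have split: "1 + z * deriv k z / k z = (1 + z\<^sup>2) / (1 - z\<^sup>2) + z * deriv p z / p z"
  proof -
    have "z * deriv p z / p z = - 2 * z\<^sup>2 / (1 - z\<^sup>2) + z * deriv k z / k z"
      using nz unfolding dp by (simp add: p_def divide_simps) (simp add: algebra_simps power2_eq_square)
    moreover have "1 = (1 + z\<^sup>2) / (1 - z\<^sup>2) + - 2 * z\<^sup>2 / (1 - z\<^sup>2)"
      using nz(2) by (simp add: divide_simps)
    ultimately show ?thesis by (simp add: add.assoc)
  qed
  have a: "norm ((1 + z\<^sup>2) / (1 - z\<^sup>2)) \<le> (1 + (norm z)\<^sup>2) / (1 - (norm z)\<^sup>2)"
    unfolding norm_divide
  proof (rule frac_le)
    show "norm (1 + z\<^sup>2) \<le> 1 + (norm z)\<^sup>2" by (metis norm_one norm_power norm_triangle_ineq)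
    show "1 - (norm z)\<^sup>2 \<le> norm (1 - z\<^sup>2)" by (metis norm_one norm_power norm_triangle_ineq2)
  qed (use r2 in auto)
  have "norm (deriv p z) * (1 - (norm z)\<^sup>2) \<le> 2 * norm (p z)"
    using Schwarz_Pick_half_plane[OF p pos z] complex_Re_le_cmod[of "p z"] by linarith
  hence "norm (deriv p z) / norm (p z) \<le> 2 / (1 - (norm z)\<^sup>2)"
    using pz r2 by (simp add: field_simps)
  hence b: "norm (z * deriv p z / p z) \<le> norm z * (2 / (1 - (norm z)\<^sup>2))"
    by (metis mult_left_mono norm_divide norm_ge_zero norm_mult times_divide_eq_right)
  have "norm (1 + z * deriv k z / k z) \<le> (1 + (norm z)\<^sup>2) / (1 - (norm z)\<^sup>2) + norm z * (2 / (1 - (norm z)\<^sup>2))"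
    unfolding split using a b norm_triangle_mono by blast
  also have "\<dots> = (1 + norm z)\<^sup>2 / ((1 + norm z) * (1 - norm z))"
    by (simp add: add_divide_distrib[symmetric] power2_eq_square algebra_simps)
  also have "\<dots> = (1 + norm z) / (1 - norm z)"
  proof -
    have "1 + norm z > 0" by (simp add: add_pos_nonneg)
    thus ?thesis by (simp add: power2_eq_square)
  qed
  finally show ?thesis .
qed

section \<open>The mean of the reciprocal of a function near one\<close>

lemma integral_circle_mean_value:
  assumes F: "F holomorphic_on ball 0 R" and r: "0 < r" "r < R"
  shows "((\<lambda>t. F (rcis r t)) has_integral 2 * of_real pi * F 0) {0..2 * pi}"
proof -
  have "((\<lambda>u. F u / (u - 0)) has_contour_integral (2 * of_real pi * \<i> * F 0)) (circlepath 0 r)"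
    by (intro Cauchy_integral_circlepath holomorphic_on_imp_continuous_on holomorphic_on_subset[OF F])
       (use r in auto)
  hence "((\<lambda>t. F (0 + r * cis t) / (0 + r * cis t - 0) * r * \<i> * cis t) has_integral (2 * of_real pi * \<i> * F 0)) {0..2*pi}"
    unfolding circlepath_def by (subst (asm) has_contour_integral_part_circlepath_iff) auto
  hence "((\<lambda>t. \<i> * F (rcis r t)) has_integral (2 * of_real pi * \<i> * F 0)) {0..2*pi}"
    by (rule has_integral_eq[rotated]) (use r in \<open>auto simp: rcis_def\<close>)
  from has_integral_mult_right[OF this, of "- \<i>"] show ?thesis
    by (simp add: mult_ac)
qed

text \<open>
  Geometrically: the disk of radius \<open>r\<close> about \<open>1\<close> is seen from the origin within the half-angle
  \<open>arcsin r\<close>, so \<open>Re w \<ge> sqrt (1 - r\<^sup>2) |w|\<close> for \<open>w = 1 + b\<close>; division by \<open>|w|\<^sup>2\<close> turns this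
  into a statement about \<open>1 / w\<close>. A real part replaces the modulus because it is harmonic and
  can be integrated exactly over a circle.
\<close>

lemma inverse_norm_le_Re_inverse:
  assumes b: "norm b \<le> r" and r: "r < 1"
  shows "1 / norm (1 + b) \<le> Re (1 / (1 + b)) / sqrt (1 - r\<^sup>2)"
proof -
  have r0: "0 \<le> r" using b norm_ge_zero order_trans by blast
  have r2: "0 < 1 - r\<^sup>2" using r0 r by (simp add: power_less_one_iff abs_square_less_1)
  have "1 + b \<noteq> 0" using b r by (metis add_eq_0_iff norm_minus_cancel norm_one not_le)
  hence n: "norm (1 + b) > 0" by simp
  have bb: "(Re b)\<^sup>2 + (Im b)\<^sup>2 \<le> r\<^sup>2"
    using b r0 power_mono[OF b, of 2] by (simp add: cmod_power2)
  have Re0: "0 \<le> 1 + Re b" using b r abs_Re_le_cmod[of b] by linarith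
  have "sqrt (1 - r\<^sup>2) * norm (1 + b) \<le> 1 + Re b"
  proof (rule power2_le_imp_le[OF _ Re0])
    have "(1 - r\<^sup>2) * ((1 + Re b)\<^sup>2 + (Im b)\<^sup>2) \<le> (1 + Re b)\<^sup>2"
    proof -
      have "(1 + Re b)\<^sup>2 - (1 - r\<^sup>2) * ((1 + Re b)\<^sup>2 + (Im b)\<^sup>2)
         = (Re b + r\<^sup>2)\<^sup>2 + (1 - r\<^sup>2) * (r\<^sup>2 - ((Re b)\<^sup>2 + (Im b)\<^sup>2))"
        by (simp add: power2_eq_square algebra_simps)
      also have "\<dots> \<ge> 0" using r2 bb by (intro add_nonneg_nonneg mult_nonneg_nonneg) auto
      finally show ?thesis by simp
    qed
    thus "(sqrt (1 - r\<^sup>2) * norm (1 + b))\<^sup>2 \<le> (1 + Re b)\<^sup>2"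
      using r2 by (simp add: power_mult_distrib cmod_power2)
  qed
  moreover have "Re (1 / (1 + b)) = (1 + Re b) / (norm (1 + b))\<^sup>2"
    by (simp add: Re_divide cmod_power2)
  ultimately have "sqrt (1 - r\<^sup>2) * norm (1 + b) / (norm (1 + b))\<^sup>2 \<le> Re (1 / (1 + b))"
    by (simp add: divide_right_mono)
  hence "sqrt (1 - r\<^sup>2) * (1 / norm (1 + b)) \<le> Re (1 / (1 + b))"
    using n by (simp add: power2_eq_square)
  thus ?thesis using r2 by (simp add: pos_le_divide_eq mult.commute)
qed

section \<open>The derivatives of a logharmonic mapping\<close>

lemma has_derivative_mult_cnj:
  assumes u: "(u has_field_derivative u') (at z)" and g: "(g has_field_derivative g') (at z)"
  shows "((\<lambda>z. u z * cnj (g z)) has_derivative (\<lambda>v. u' * v * cnj (g z) + u z * cnj (g' * v))) (at z)"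
  using u g unfolding has_field_derivative_def
  by (auto intro!: derivative_eq_intros simp: algebra_simps)

text \<open>
  Since \<open>f = u cnj g\<close> with \<open>u = z h\<close>, the Wirtinger derivatives are \<open>u' cnj g\<close> and
  \<open>u cnj g'\<close>, and the logharmonic equation becomes \<open>g'/g = a u'/u\<close>. At the origin \<open>f\<close> vanishes
  and the equation says nothing.
\<close>

lemma logarithmic_derivatives_dilatation:
  assumes a: "logharmonic_wrt a f" and h: "h holomorphic_on unit_disk" and g: "g holomorphic_on unit_disk"
    and nz: "\<And>z. z \<in> unit_disk \<Longrightarrow> h z * g z \<noteq> 0"
    and f: "\<And>z. z \<in> unit_disk \<Longrightarrow> f z = z * h z * cnj (g z)"
    and z: "z \<in> unit_disk" "z \<noteq> 0"
  shows "z * deriv g z / g z = a z * (1 + z * deriv h z / h z)"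
proof -
  define u' where "u' = h z + z * deriv h z"
  have du: "((\<lambda>z. z * h z) has_field_derivative u') (at z)"
    unfolding u'_def by (auto intro!: derivative_eq_intros holomorphic_derivI[OF h _ z(1)])
  have D: "(f has_derivative (\<lambda>v. u' * v * cnj (g z) + z * h z * cnj (deriv g z * v))) (at z)"
    by (rule has_derivative_transform_within_open[OF has_derivative_mult_cnj[OF du holomorphic_derivI[OF g _ z(1)]], of unit_disk])
       (use z f in auto)
  have w: "wirtinger f z = u' * cnj (g z)" "wirtinger_bar f z = z * h z * cnj (deriv g z)"
    unfolding wirtinger_def wirtinger_bar_def frechet_derivative_at[OF D, symmetric]
    by (simp_all add: field_simps)
  have nz': "h z \<noteq> 0" "g z \<noteq> 0" using nz[OF z(1)] by auto
  hence fz: "f z \<noteq> 0" using f z by simp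
  hence "cnj (wirtinger_bar f z / f z) = a z * (wirtinger f z / f z)"
    using a z unfolding logharmonic_wrt_def by blast
  hence "deriv g z / g z = a z * (u' / (z * h z))"
    using nz' z unfolding w f[OF z(1)] by simp
  hence "z * (deriv g z / g z) = a z * (z * (u' / (z * h z)))" by simp
  thus ?thesis using nz' z by (simp add: u'_def add_divide_distrib distrib_left)
qed

text \<open>
  By continuity the identity \<open>z g'/g = a (1 + z h'/h)\<close> persists at the origin, where it reads
  \<open>0 = a 0\<close>.
\<close>

lemma dilatation_at_0:
  assumes a: "logharmonic_wrt a f" and h: "h holomorphic_on unit_disk" and g: "g holomorphic_on unit_disk"
    and nz: "\<And>z. z \<in> unit_disk \<Longrightarrow> h z * g z \<noteq> 0"
    and f: "\<And>z. z \<in> unit_disk \<Longrightarrow> f z = z * h z * cnj (g z)"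
    and hol: "a holomorphic_on unit_disk"
  shows "a 0 = 0"
proof -
  let ?e = "\<lambda>z. a z * (1 + z * deriv h z / h z) - z * deriv g z / g z"
  have "?e holomorphic_on unit_disk"
    using nz by (intro holomorphic_intros h g hol) auto
  hence "continuous_on unit_disk ?e" by (rule holomorphic_on_imp_continuous_on)
  hence "isCont ?e 0" by (simp add: continuous_on_eq_continuous_at)
  hence "(?e \<longlongrightarrow> ?e 0) (at 0)" by (simp only: isCont_def)
  moreover have "(?e \<longlongrightarrow> 0) (at 0)"
  proof (rule Lim_transform_within_open[OF tendsto_const, of unit_disk])
    show "0 = ?e z" if "z \<in> unit_disk" "z \<noteq> 0" for z
      using logarithmic_derivatives_dilatation[OF a h g nz f that] by simp
  qed auto
  ultimately have "?e 0 = 0" by (rule LIM_unique)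
  thus ?thesis by simp
qed

lemma vector_derivative_circle_image:
  assumes a: "logharmonic_wrt a f" and h: "h holomorphic_on unit_disk" and g: "g holomorphic_on unit_disk"
    and nz: "\<And>z. z \<in> unit_disk \<Longrightarrow> h z * g z \<noteq> 0"
    and f: "\<And>z. z \<in> unit_disk \<Longrightarrow> f z = z * h z * cnj (g z)"
    and r: "0 < r" "r < 1" and z: "z = rcis r t"
  defines "Q \<equiv> 1 + z * deriv h z / h z"
  shows "vector_derivative (\<lambda>t. f (rcis r t)) (at t) = \<i> * f z * (Q - cnj (a z * Q))"
proof -
  have zd: "z \<in> unit_disk" "z \<noteq> 0" using r z by auto
  define u' where "u' = h z + z * deriv h z"
  have du: "((\<lambda>z. z * h z) has_field_derivative u') (at z)"
    unfolding u'_def by (auto intro!: derivative_eq_intros holomorphic_derivI[OF h _ zd(1)])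
  let ?D = "\<lambda>v. u' * v * cnj (g z) + z * h z * cnj (deriv g z * v)"
  have D: "(f has_derivative ?D) (at z)"
    by (rule has_derivative_transform_within_open[OF has_derivative_mult_cnj[OF du holomorphic_derivI[OF g _ zd(1)]], of unit_disk])
       (use zd f in auto)
  have "(rcis r has_vector_derivative \<i> * rcis r t) (at t)"
    unfolding rcis_def[abs_def] has_vector_derivative_def
    by (auto intro!: derivative_eq_intros simp: scaleR_conv_of_real algebra_simps)
  hence "(rcis r has_derivative (\<lambda>x. x *\<^sub>R (\<i> * z))) (at t)" 
    by (simp add: has_vector_derivative_def z)
  from diff_chain_at[OF this D[unfolded z]]
  have "((\<lambda>t. f (rcis r t)) has_derivative (\<lambda>x. ?D (x *\<^sub>R (\<i> * z)))) (at t)"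
    by (simp add: o_def z)
  also have "(\<lambda>x::real. ?D (x *\<^sub>R (\<i> * z))) = (\<lambda>x. x *\<^sub>R ?D (\<i> * z))"
    by (auto simp: scaleR_conv_of_real algebra_simps)
  finally have "vector_derivative (\<lambda>t. f (rcis r t)) (at t) = ?D (\<i> * z)"
    by (intro vector_derivative_at) (simp add: has_vector_derivative_def)
  also have "\<dots> = \<i> * f z * (Q - cnj (z * deriv g z / g z))"
    using nz[OF zd(1)] by (simp add: f[OF zd(1)] Q_def u'_def field_simps)
  also have "z * deriv g z / g z = a z * Q"
    unfolding Q_def by (rule logarithmic_derivatives_dilatation[OF a h g nz f zd])
  finally show ?thesis .
qed

text \<open>
  Here \<open>|Q - cnj (a Q)| \<le> (1 + r) |Q|\<close>, and \<open>Q = (z \<phi>'/\<phi>) / (1 + a)\<close>. Keeping the real part of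
  \<open>1 / (1 + a)\<close> in the bound makes the right-hand side integrable in closed form once
  \<open>norm (f z)\<close> is replaced by its maximum.
\<close>

lemma norm_vector_derivative_circle_image_le:
  assumes a: "a \<in> dilatations" "logharmonic_wrt a f"
    and h: "h holomorphic_on unit_disk" "h 0 = 1" and g: "g holomorphic_on unit_disk" "g 0 = 1"
    and nz: "\<And>z. z \<in> unit_disk \<Longrightarrow> h z * g z \<noteq> 0"
    and f: "\<And>z. z \<in> unit_disk \<Longrightarrow> f z = z * h z * cnj (g z)"
    and tr: "typically_real (\<lambda>z. z * h z * g z)"
    and r: "0 < r" "r < 1" and z: "z = rcis r t"
  shows "norm (vector_derivative (\<lambda>t. f (rcis r t)) (at t))
    \<le> norm (f z) * ((1 + r)\<^sup>2 / ((1 - r) * sqrt (1 - r\<^sup>2))) * Re (1 / (1 + a z))"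
proof -
  have hol: "a holomorphic_on unit_disk" and lt1: "\<And>z. z \<in> unit_disk \<Longrightarrow> norm (a z) < 1"
    using a(1) by (auto simp: dilatations_def)
  have zd: "z \<in> unit_disk" "z \<noteq> 0" and nz': "norm z = r" using r z by auto
  have az: "norm (a z) \<le> r"
    using Schwarz_Lemma(1)[OF hol dilatation_at_0[OF a(2) h(1) g(1) nz f hol] _, of z] lt1 zd nz' by auto
  define Q where "Q = 1 + z * deriv h z / h z"
  have "((\<lambda>z. h z * g z) has_field_derivative h z * deriv g z + deriv h z * g z) (at z)"
    by (rule DERIV_mult'[OF holomorphic_derivI[OF h(1) _ zd(1)] holomorphic_derivI[OF g(1) _ zd(1)]]) auto
  hence dk: "deriv (\<lambda>z. h z * g z) z = h z * deriv g z + deriv h z * g z"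
    by (rule DERIV_imp_deriv)
  have "1 + z * deriv (\<lambda>z. h z * g z) z / (h z * g z) = Q + z * deriv g z / g z"
    using nz[OF zd(1)] unfolding dk Q_def by (simp add: field_simps)
  also have "\<dots> = Q * (1 + a z)"
    using logarithmic_derivatives_dilatation[OF a(2) h(1) g(1) nz f zd] by (simp only: Q_def[symmetric] distrib_left mult_1_right) (simp only: mult.commute)
  finally have "norm (Q * (1 + a z)) \<le> (1 + r) / (1 - r)"
    using norm_log_derivative_typically_real[of "\<lambda>z. h z * g z" z] tr h g zd nz'
    by (simp add: mult.assoc holomorphic_on_mult)
  moreover have "1 + a z \<noteq> 0"
    using lt1[OF zd(1)] by (metis add_eq_0_iff norm_minus_cancel norm_one less_irrefl)
  ultimately have "norm Q \<le> (1 + r) / (1 - r) / norm (1 + a z)"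
    by (subst pos_le_divide_eq) (simp_all add: norm_mult)
  hence "norm Q \<le> (1 + r) / (1 - r) * (1 / norm (1 + a z))" by simp
  also have "\<dots> \<le> (1 + r) / (1 - r) * (Re (1 / (1 + a z)) / sqrt (1 - r\<^sup>2))"
    by (rule mult_left_mono[OF inverse_norm_le_Re_inverse[OF az r(2)]]) (use r in auto)
  finally have Q: "norm Q \<le> (1 + r) / (1 - r) * (Re (1 / (1 + a z)) / sqrt (1 - r\<^sup>2))" .
  have "norm (Q - cnj (a z * Q)) \<le> norm Q + norm (a z) * norm Q"
    by (metis norm_triangle_ineq4 complex_mod_cnj norm_mult)
  also have "\<dots> \<le> (1 + r) * norm Q"
    using mult_right_mono[OF az, of "norm Q"] by (simp add: algebra_simps)
  also have "\<dots> \<le> (1 + r) * ((1 + r) / (1 - r) * (Re (1 / (1 + a z)) / sqrt (1 - r\<^sup>2)))"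
    by (rule mult_left_mono[OF Q]) (use r in auto)
  also have "\<dots> = (1 + r)\<^sup>2 / ((1 - r) * sqrt (1 - r\<^sup>2)) * Re (1 / (1 + a z))"
    by (simp add: power2_eq_square)
  finally have "norm (f z) * norm (Q - cnj (a z * Q))
      \<le> norm (f z) * ((1 + r)\<^sup>2 / ((1 - r) * sqrt (1 - r\<^sup>2)) * Re (1 / (1 + a z)))"
    by (rule mult_left_mono) simp
  moreover have "vector_derivative (\<lambda>t. f (rcis r t)) (at t) = \<i> * f z * (Q - cnj (a z * Q))"
    unfolding Q_def by (rule vector_derivative_circle_image[OF a(2) h(1) g(1) nz f r z])
  ultimately show ?thesis by (simp add: norm_mult mult.assoc del: complex_cnj_mult)
qed

section \<open>The length of the image of a circle\<close>

lemma image_circle_length_le: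
  assumes fT: "f \<in> T_Lh" and r: "0 < r" "r < 1"
    and M: "\<And>z. norm z = r \<Longrightarrow> norm (f z) \<le> m"
  shows "image_circle_length f r \<le> 2 * pi * m * ((1 + r)\<^sup>2 / ((1 - r) * sqrt (1 - r\<^sup>2)))"
proof -
  obtain a h g where a: "a \<in> dilatations" "logharmonic_wrt a f"
    and h: "h holomorphic_on unit_disk" "h 0 = 1" and g: "g holomorphic_on unit_disk" "g 0 = 1"
    and nz: "\<And>z. z \<in> unit_disk \<Longrightarrow> h z * g z \<noteq> 0"
    and f: "\<And>z. z \<in> unit_disk \<Longrightarrow> f z = z * h z * cnj (g z)"
    and tr: "typically_real (\<lambda>z. z * h z * g z)"
    using fT unfolding T_Lh_def by blast
  have hol: "a holomorphic_on unit_disk" and lt1: "\<And>z. z \<in> unit_disk \<Longrightarrow> norm (a z) < 1"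
    using a(1) by (auto simp: dilatations_def)
  have a1: "1 + a z \<noteq> 0" if "z \<in> unit_disk" for z
    using lt1[OF that] by (metis add_eq_0_iff norm_minus_cancel norm_one less_irrefl)
  define C where "C = (1 + r)\<^sup>2 / ((1 - r) * sqrt (1 - r\<^sup>2))"
  have "r\<^sup>2 < 1" using r by (simp add: abs_square_less_1)
  hence C: "0 \<le> C" using r by (simp add: C_def)
  have disk: "rcis r t \<in> unit_disk" for t using r by simp
  let ?v = "\<lambda>t. norm (vector_derivative (\<lambda>t. f (rcis r t)) (at t))"
  let ?Q = "\<lambda>z. 1 + z * deriv h z / h z"
  have v: "?v = (\<lambda>t. norm (\<i> * (rcis r t * h (rcis r t) * cnj (g (rcis r t)))
      * (?Q (rcis r t) - cnj (a (rcis r t) * ?Q (rcis r t)))))"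
    using vector_derivative_circle_image[OF a(2) h(1) g(1) nz f r refl] f[OF disk] by (simp only:)
  have cont: "continuous_on A (\<lambda>t. F (rcis r t))" if "F holomorphic_on unit_disk" for F A
    by (rule continuous_on_compose2[OF holomorphic_on_imp_continuous_on[OF that]])
       (use r in \<open>auto intro!: continuous_intros simp: rcis_def norm_mult\<close>)
  have "?Q holomorphic_on unit_disk" using nz by (intro holomorphic_intros h) auto
  hence "continuous_on {0..2 * pi} ?v" unfolding v
    by (intro continuous_intros cont[of ?Q] cont[OF h(1)] cont[OF g(1)] cont[OF hol] cont[of "\<lambda>z. z"]) auto
  hence int: "(?v has_integral image_circle_length f r) {0..2 * pi}"
    unfolding image_circle_length_def
    by (intro integrable_integral integrable_continuous_interval)
  have a0: "a 0 = 0" by (rule dilatation_at_0[OF a(2) h(1) g(1) nz f hol])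
  have "((\<lambda>t. 1 / (1 + a (rcis r t))) has_integral 2 * of_real pi * (1 / (1 + a 0))) {0..2 * pi}"
    by (rule integral_circle_mean_value[of "\<lambda>z. 1 / (1 + a z)" 1])
       (use a1 r in \<open>auto intro!: holomorphic_intros hol\<close>)
  from has_integral_linear[OF this bounded_linear_Re]
  have "((\<lambda>t. Re (1 / (1 + a (rcis r t)))) has_integral 2 * pi) {0..2 * pi}"
    by (simp add: o_def a0)
  hence maj: "((\<lambda>t. m * C * Re (1 / (1 + a (rcis r t)))) has_integral m * C * (2 * pi)) {0..2 * pi}"
    by (rule has_integral_mult_right)
  have "image_circle_length f r \<le> m * C * (2 * pi)"
  proof (rule has_integral_le[OF int maj])
    fix t :: real
    let ?z = "rcis r t"
    have "- 1 \<le> Re (a ?z)" using lt1[OF disk[of t]] abs_Re_le_cmod[of "a ?z"] by linarith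
    hence Re0: "0 \<le> Re (1 / (1 + a ?z))" by (simp add: Re_divide)
    have "?v t \<le> norm (f ?z) * C * Re (1 / (1 + a ?z))"
      unfolding C_def by (rule norm_vector_derivative_circle_image_le[OF a h g nz f tr r refl])
    also have "\<dots> \<le> m * C * Re (1 / (1 + a ?z))"
      using M[of ?z] r by (intro mult_right_mono C Re0) auto
    finally show "?v t \<le> m * C * Re (1 / (1 + a ?z))" .
  qed
  thus ?thesis by (simp add: C_def mult_ac)
qed

text \<open>
  After clearing denominators the claim is
  \<open>(1 + r)\<^sup>2 sqrt (1 - r\<^sup>2) \<le> 2 (1 + r) + 4 r\<^sup>2 (1 - r)\<close>, which holds already without the last
  summand because \<open>1 + r \<le> 2\<close> and \<open>sqrt (1 - r\<^sup>2) \<le> 1\<close>.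
\<close>

lemma circle_length_constant_le:
  fixes r :: real
  assumes r: "0 < r" "r < 1"
  shows "(1 + r)\<^sup>2 / ((1 - r) * sqrt (1 - r\<^sup>2))
    \<le> 2 * ((1 + r + 2 * r^2 - 2 * r^3) / ((1 - r) * (1 - r^2)))"
proof -
  have r2: "0 < 1 - r\<^sup>2" using r by (simp add: abs_square_less_1)
  define s where "s = sqrt (1 - r\<^sup>2)"
  have s: "0 < s" "s \<le> 1" "s * s = 1 - r\<^sup>2" using r2 by (auto simp: s_def)
  have "(1 + r) * s \<le> 2 * 1" using r s by (intro mult_mono) auto
  hence "(1 + r) * ((1 + r) * s) \<le> (1 + r) * 2" using r by (intro mult_left_mono) auto
  moreover have "0 \<le> r\<^sup>2 * (1 - r)" using r by simp
  ultimately have "(1 + r)\<^sup>2 * s \<le> 2 * (1 + r + 2 * r^2 - 2 * r^3)"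
    by (simp add: power2_eq_square power3_eq_cube algebra_simps)
  hence "(1 + r)\<^sup>2 * s / ((1 - r) * (s * s)) \<le> 2 * (1 + r + 2 * r^2 - 2 * r^3) / ((1 - r) * (s * s))"
    using r s(1) by (intro divide_right_mono mult_nonneg_nonneg) auto
  thus ?thesis using s r2 unfolding s_def[symmetric] s(3)[symmetric] by simp
qed

theorem theorem3:
  fixes f :: "complex \<Rightarrow> complex" and r :: real and M :: "real \<Rightarrow> real"
  assumes "f \<in> T_Lh"
    and "0 < r" and "r < 1"
    and "\<And>z. norm z = r \<Longrightarrow> norm (f z) \<le> M r"
  shows "image_circle_length f r
    \<le> 4 * pi * M r * ((1 + r + 2 * r^2 - 2 * r^3) / ((1 - r) * (1 - r^2)))"
proof -
  have "norm (complex_of_real r) = r" using assms(2) by simp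
  hence "0 \<le> M r" using assms(4) norm_ge_zero order_trans by blast
  hence "2 * pi * M r * ((1 + r)\<^sup>2 / ((1 - r) * sqrt (1 - r\<^sup>2)))
    \<le> 2 * pi * M r * (2 * ((1 + r + 2 * r^2 - 2 * r^3) / ((1 - r) * (1 - r^2))))"
    by (intro mult_left_mono circle_length_constant_le assms) auto
  also have "\<dots> = 4 * pi * M r * ((1 + r + 2 * r^2 - 2 * r^3) / ((1 - r) * (1 - r^2)))"
    by simp
  finally show ?thesis using image_circle_length_le[OF assms(1-4)] by linarith
qed

end
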